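(* Consider the full-order solution and the WST-LSPG solution over windows $k\in\{0,\dots,N_w-1\}$, as defined in the context. Assume: (A1) there is $\kappa>0$ with $\|\boldsymbol f(\boldsymbol w,t)-\boldsymbol f(\boldsymbol y,t)\|_2\le\kappa\|\boldsymbol w-\boldsymbol y\|_2$ for all $\boldsymbol w,\boldsymbol y\in\mathbb R^{N_s}$, $t\in[0,T]$; (A2) the time step is sufficiently small that $\sigma_{\min}(\boldsymbol A^k)-\sigma_{\max}(\boldsymbol B^k)\,\Delta t\,\kappa>0$. Set $a^k=\sigma_{\min}(\boldsymbol A^k)-\sigma_{\max}(\boldsymbol B^k)\Delta t\,\kappa$ and $b^k=\sigma_{\max}(\boldsymbol A_0^k)+\Delta t\,\kappa\,\sigma_{\max}(\boldsymbol B_0^k)$. Then the error between the WST-LSPG solution and the full-order solution over the $k$-th window can be bounded, a priori, by $$\|\boldsymbol e^k\|_2\le\frac1{a^k}\big\|\overline{\boldsymbol r}^k(\mathbb P\boldsymbol u^k;\mathbb P\boldsymbol u_0^k)\big\|_2+\frac{2b^k}{a^k}\|\boldsymbol e_0^k\|_2,$$ where $\boldsymbol e^k=\tilde{\boldsymbol u}^k-\boldsymbol u^k$, $\boldsymbol e_0^k=\tilde{\boldsymbol u}_0^k-\boldsymbol u_0^k$, $\mathbb P\boldsymbol u^k=\arg\min_{\boldsymbol w\in\mathcal S^k}\|\boldsymbol u^k-\boldsymbol w\|_2$ is the $\ell^2$-orthogonal projection of the full-order solution onto the trial space of window $k$, and, analogously, $\mathbb P\boldsymbol u_0^k$ is the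 $\ell^2$-orthogonal projection of the full-order initial conditions $\boldsymbol u_0^k$ for the $k$-th window onto the trial subspace.
   Context: All superscripts $k$ are window indices, not powers. $\sigma_{\min},\sigma_{\max}$ denote minimum and maximum singular values; $\|\cdot\|_2$ is the Euclidean norm. A parameter value is fixed and suppressed. Full-order model: an ODE $\dot{\boldsymbol u}=\boldsymbol f(\boldsymbol u,t)$ with $\boldsymbol f:\mathbb R^{N_s}\times[0,T]\to\mathbb R^{N_s}$ and initial state $\boldsymbol u^{\mathrm{init}}\in\mathbb R^{N_s}$ is discretized at times $t^0<t^1<\dots<t^{N_t}$ with constant step $\Delta t>0$ by a linear multistep method with stencil width $s_n$ at step $n$: coefficients $\alpha_j^n,\beta_j^n\in\mathbb R$, $0\le j\le s_n$, with $\alpha_0^n\ne0$ and $\sum_{j=0}^{s_n}\alpha_j^n=0$, and residual $$\boldsymbol r^n(\boldsymbol w^n;\boldsymbol w^{n-1},\dots,\boldsymbol w^{n-s_n})=\sum_{j=0}^{s_n}\alpha_j^n\boldsymbol w^{n-j}-\Delta t\sum_{j=0}^{s_n}\beta_j^n\boldsymbol f(\boldsymbol w^{n-j},t^{n-j}).$$ Windows: the steps $1,\dots,N_t$ are partitioned into $N_w$ consecutive windows; window $k\in\{0,\dots,N_w-1\}$ contains $N_t^k$ steps, namely $\theta(k),\dots,\theta(k)+N_t^k-1$, with $\theta(k)=1+\sum_{j=0}^{k-1}N_t^j$. The stencil width at the first step of each window is one ($s_{\theta(k)}=1$), and no stencil inside a window reaches back before the state at step $\theta(k)-1$ (i.e.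 $s_{\theta(k)+\ell-1}\le\ell$ for $1\le\ell\le N_t^k$). Windowed residual: for $\boldsymbol w=[(\boldsymbol w^1)^T\cdots(\boldsymbol w^{N_t^k})^T]^T\in\mathbb R^{N_sN_t^k}$ and starting state $\boldsymbol w_0\in\mathbb R^{N_s}$, $\overline{\boldsymbol r}^k(\boldsymbol w;\boldsymbol w_0)\in\mathbb R^{N_sN_t^k}$ stacks the residuals of all steps of window $k$ (with $\boldsymbol w^\ell$ the state at step $\theta(k)+\ell-1$ and $\boldsymbol w_0$ the state at step $\theta(k)-1$). Equivalently $$\overline{\boldsymbol r}^k(\boldsymbol w;\boldsymbol w_0)=\boldsymbol A^k\boldsymbol w-\Delta t\,\boldsymbol B^k\,\overline{\boldsymbol f}^k(\boldsymbol w)+\boldsymbol A_0^k\boldsymbol w_0-\Delta t\,\boldsymbol B_0^k\boldsymbol f(\boldsymbol w_0,t^{\theta(k)-1}),$$ where $\overline{\boldsymbol f}^k(\boldsymbol w)$ stacks $\boldsymbol f(\boldsymbol w^\ell,t^{\theta(k)+\ell-1})$, $\ell=1,\dots,N_t^k$; $\boldsymbol A^k\in\mathbb R^{N_sN_t^k\times N_sN_t^k}$ has $N_s\times N_s$ block $(\ell,\ell-j)$ equal to $\alpha_j^{\theta(k)+\ell-1}\boldsymbol I$ for $0\le j\le s_{\theta(k)+\ell-1}$, $\ell-j\ge1$, other blocks zero; $\boldsymbol A_0^k\in\mathbb R^{N_sN_t^k\times N_s}$ has $\ell$-th block $\alpha_\ell^{\theta(k)+\ell-1}\boldsymbol I$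 if $s_{\theta(k)+\ell-1}=\ell$ and zero otherwise; $\boldsymbol B^k,\boldsymbol B_0^k$ are defined identically with $\beta$ in place of $\alpha$. Full-order solution: $\boldsymbol u^k\in\mathbb R^{N_sN_t^k}$ with starting state (initial conditions for the window) $\boldsymbol u_0^k$ satisfies $\overline{\boldsymbol r}^k(\boldsymbol u^k;\boldsymbol u_0^k)=\boldsymbol 0$, where $\boldsymbol u_0^0=\boldsymbol u^{\mathrm{init}}$ and, for $k\ge1$, $\boldsymbol u_0^k$ is the last $N_s$-block of $\boldsymbol u^{k-1}$. WST-LSPG solution (windowed space--time least-squares Petrov--Galerkin, no hyper-reduction): computed sequentially for $k=0,\dots,N_w-1$. The starting state is $\tilde{\boldsymbol u}_0^0=\boldsymbol u^{\mathrm{init}}$ and, for $k\ge1$, $\tilde{\boldsymbol u}_0^k$ is the last $N_s$-block of $\tilde{\boldsymbol u}^{k-1}$. Given a basis matrix $\boldsymbol\Pi^k\in\mathbb R^{N_sN_t^k\times n^k}$, the affine trial subspace of window $k$ is $\mathcal S^k=\{\boldsymbol u_{\mathrm{ref}}^k+\boldsymbol\Pi^k\boldsymbol z:\boldsymbol z\in\mathbb R^{n^k}\}$, where $\boldsymbol u_{\mathrm{ref}}^k$ stacks $N_t^k$ copies of $\tilde{\boldsymbol u}_0^k$, and $\tilde{\boldsymbol u}^k\in\mathcal S^k$ is a minimizer of $\boldsymbol w\mapsto\|\overline{\boldsymbol r}^k(\boldsymbol w;\tilde{\boldsymbol u}_0^k)\|_2^2$ over $\mathcal S^k$. Trial subspace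 for the initial conditions of a window: the starting state of window $k\ge1$ is the state at the last step of window $k-1$, so the trial subspace onto which $\boldsymbol u_0^k$ is projected is the set of last $N_s$-blocks of elements of $\mathcal S^{k-1}$; for $k=0$ the initial state is represented exactly, $\mathbb P\boldsymbol u_0^0=\boldsymbol u^{\mathrm{init}}$. *)

theory Defs
  imports "Jordan_Normal_Form.Spectral_Radius"
begin

definition l2norm :: "real vec \<Rightarrow> real" where
  "l2norm v = sqrt (scalar_prod v v)"

text \<open>An \<open>m \<times> n\<close> matrix has \<open>min m n\<close> singular values (with multiplicity); hence the
  smaller of the two Gram matrices, so that no spurious zero enters for non-square matrices.\<close>

definition singular_values :: "real mat \<Rightarrow> real set" where
  "singular_values A =
     sqrt ` spectrum (if dim_col A \<le> dim_row A then transpose_mat A * A else A * transpose_mat A)"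

definition sigma_min :: "real mat \<Rightarrow> real" where
  "sigma_min A = Min (singular_values A)"

definition sigma_max :: "real mat \<Rightarrow> real" where
  "sigma_max A = Max (singular_values A)"

definition l2_proj :: "real vec set \<Rightarrow> real vec \<Rightarrow> real vec" where
  "l2_proj S x = (ARG_MIN (\<lambda>w. l2norm (x - w)) w. w \<in> S)"

text \<open>Blocks have size \<open>m\<close> and are numbered from \<open>1\<close>; vector and matrix entries are
  numbered from \<open>0\<close>, so entry \<open>i\<close> is entry \<open>i mod m\<close> of block \<open>i div m + 1\<close>.\<close>

definition block :: "nat \<Rightarrow> real vec \<Rightarrow> nat \<Rightarrow> real vec" where
  "block m w l = vec m (\<lambda>i. vec_index w ((l - 1) * m + i))"

definition stack :: "nat \<Rightarrow> nat \<Rightarrow> (nat \<Rightarrow> real vec) \<Rightarrow> real vec" where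
  "stack m L g = vec (m * L) (\<lambda>i. vec_index (g (i div m + 1)) (i mod m))"

definition lmm_residual ::
  "nat \<Rightarrow> (real vec \<Rightarrow> real \<Rightarrow> real vec) \<Rightarrow> (nat \<Rightarrow> real) \<Rightarrow> real \<Rightarrow> (nat \<Rightarrow> nat)
    \<Rightarrow> (nat \<Rightarrow> nat \<Rightarrow> real) \<Rightarrow> (nat \<Rightarrow> nat \<Rightarrow> real) \<Rightarrow> nat \<Rightarrow> (nat \<Rightarrow> real vec) \<Rightarrow> real vec" where
  "lmm_residual Ns f t dt s \<alpha> \<beta> n x =
     vec Ns (\<lambda>i. (\<Sum>j\<le>s n. \<alpha> n j * vec_index (x (n - j)) i)
                 - dt * (\<Sum>j\<le>s n. \<beta> n j * vec_index (f (x (n - j)) (t (n - j))) i))"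

definition theta :: "(nat \<Rightarrow> nat) \<Rightarrow> nat \<Rightarrow> nat" where
  "theta Nt k = 1 + (\<Sum>j<k. Nt j)"

text \<open>The state at global step \<open>n \<ge> theta Nt k - 1\<close>, read off from the unknowns \<open>w\<close> of
  window \<open>k\<close> and its starting state \<open>w0\<close>.\<close>

definition window_state ::
  "nat \<Rightarrow> (nat \<Rightarrow> nat) \<Rightarrow> nat \<Rightarrow> real vec \<Rightarrow> real vec \<Rightarrow> nat \<Rightarrow> real vec" where
  "window_state Ns Nt k w w0 n = (if n < theta Nt k then w0 else block Ns w (n + 1 - theta Nt k))"

definition window_residual ::
  "nat \<Rightarrow> (real vec \<Rightarrow> real \<Rightarrow> real vec) \<Rightarrow> (nat \<Rightarrow> real) \<Rightarrow> real \<Rightarrow> (nat \<Rightarrow> nat)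
    \<Rightarrow> (nat \<Rightarrow> nat \<Rightarrow> real) \<Rightarrow> (nat \<Rightarrow> nat \<Rightarrow> real) \<Rightarrow> (nat \<Rightarrow> nat)
    \<Rightarrow> nat \<Rightarrow> real vec \<Rightarrow> real vec \<Rightarrow> real vec" where
  "window_residual Ns f t dt s \<alpha> \<beta> Nt k w w0 =
     stack Ns (Nt k)
       (\<lambda>l. lmm_residual Ns f t dt s \<alpha> \<beta> (theta Nt k + l - 1) (window_state Ns Nt k w w0))"

text \<open>With \<open>c = \<alpha>\<close> the following two are the matrices \<open>A\<close> and \<open>A\<^sub>0\<close> of window \<open>k\<close>,
  with \<open>c = \<beta>\<close> the matrices \<open>B\<close> and \<open>B\<^sub>0\<close>.\<close>

definition window_mat ::
  "nat \<Rightarrow> (nat \<Rightarrow> nat) \<Rightarrow> (nat \<Rightarrow> nat) \<Rightarrow> (nat \<Rightarrow> nat \<Rightarrow> real) \<Rightarrow> nat \<Rightarrow> real mat" where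
  "window_mat Ns s Nt c k = mat (Ns * Nt k) (Ns * Nt k) (\<lambda>(p, q).
     let l = p div Ns + 1; m = q div Ns + 1; n = theta Nt k + l - 1
     in if p mod Ns = q mod Ns \<and> m \<le> l \<and> l - m \<le> s n then c n (l - m) else 0)"

definition window_mat0 ::
  "nat \<Rightarrow> (nat \<Rightarrow> nat) \<Rightarrow> (nat \<Rightarrow> nat) \<Rightarrow> (nat \<Rightarrow> nat \<Rightarrow> real) \<Rightarrow> nat \<Rightarrow> real mat" where
  "window_mat0 Ns s Nt c k = mat (Ns * Nt k) Ns (\<lambda>(p, q).
     let l = p div Ns + 1; n = theta Nt k + l - 1
     in if p mod Ns = q \<and> s n = l then c n l else 0)"

definition trial_space :: "nat \<Rightarrow> nat \<Rightarrow> real mat \<Rightarrow> real vec \<Rightarrow> real vec set" where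
  "trial_space Ns L V x0 =
     {stack Ns L (\<lambda>_. x0) + V *\<^sub>v z | z. z \<in> carrier_vec (dim_col V)}"

end

theory Submission
  imports Defs "HOL-Analysis.L2_Norm"
begin

text \<open>
  The residual of a window splits as \<open>r(w; w\<^sub>0) = G(w) + H(w\<^sub>0)\<close>, where the Lipschitz
  condition gives \<open>\<parallel>G(w) - G(y)\<parallel> \<ge> a \<parallel>w - y\<parallel>\<close> and \<open>\<parallel>H(v) - H(w)\<parallel> \<le> b \<parallel>v - w\<parallel>\<close>.
  Comparing with the vanishing residual of the full-order solution bounds \<open>a \<parallel>e\<parallel>\<close> by the residual
  of the computed solution plus \<open>b \<parallel>e\<^sub>0\<parallel>\<close>. By minimality that residual is at most the one at the
  projection \<open>P u\<close>; replacing its starting state by \<open>P u\<^sub>0\<close> costs at most \<open>b\<close> times the distance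
  of the computed starting state from \<open>P u\<^sub>0\<close>. The computed starting state lies in the affine space
  projected onto and projections are nonexpansive, so this is again at most \<open>b \<parallel>e\<^sub>0\<parallel>\<close>.

  The singular value bounds need the extreme values of the Rayleigh quotient of a symmetric matrix
  to be eigenvalues. Instead of compactness of the sphere, the proof uses that a positive
  semidefinite invertible form is bounded away from \<open>0\<close> on the unit sphere.
\<close>

section \<open>Singular values and the Euclidean norm\<close>

lemma l2norm_L2_set: "v \<in> carrier_vec n \<Longrightarrow> l2norm v = L2_set (($) v) {..<n}"
  by (auto simp: l2norm_def L2_set_def scalar_prod_def power2_eq_square atLeast0LessThan)

lemma scalar_prod_self_nonneg [simp]: "0 \<le> (v :: real vec) \<bullet> v"
  by (simp add: scalar_prod_def sum_nonneg)

lemma l2norm_nonneg [simp]: "0 \<le> l2norm v"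
  by (simp add: l2norm_def)

lemma l2norm_power2: "(l2norm v)\<^sup>2 = v \<bullet> v"
  by (simp add: l2norm_def)

lemma scalar_prod_self_eq_0_iff:
  "v \<in> carrier_vec n \<Longrightarrow> (v :: real vec) \<bullet> v = 0 \<longleftrightarrow> v = 0\<^sub>v n"
  by (auto simp: scalar_prod_def sum_nonneg_eq_0_iff intro!: eq_vecI)

lemma l2norm_add_le:
  "v \<in> carrier_vec n \<Longrightarrow> w \<in> carrier_vec n \<Longrightarrow> l2norm (v + w) \<le> l2norm v + l2norm w"
  using L2_set_triangle_ineq[of "($) v" "($) w" "{..<n}"]
  by (simp add: l2norm_L2_set[of _ n] cong: L2_set_cong_simp)

lemma l2norm_smult: "l2norm (c \<cdot>\<^sub>v v) = \<bar>c\<bar> * l2norm v"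
  by (simp add: l2norm_def real_sqrt_mult flip: mult.assoc)

lemma l2norm_minus_le:
  assumes "v \<in> carrier_vec n" "w \<in> carrier_vec n"
  shows "l2norm (v - w) \<le> l2norm v + l2norm w"
proof -
  have "v - w = v + (-1) \<cdot>\<^sub>v w"
    using assms by auto
  then show ?thesis
    using l2norm_add_le[of v n "(-1) \<cdot>\<^sub>v w"] assms by (simp add: l2norm_smult)
qed

lemma l2norm_minus_commute:
  assumes "v \<in> carrier_vec n" "w \<in> carrier_vec n"
  shows "l2norm (v - w) = l2norm (w - v)"
proof -
  have "v - w = (-1) \<cdot>\<^sub>v (w - v)"
    using assms by auto
  then show ?thesis
    by (simp add: l2norm_smult)
qed

section \<open>Extreme eigenvalues of symmetric matrices\<close>

text \<open>A product of two coordinates is at most \<open>x \<bullet> x\<close>, so the sum of the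
  absolute entries serves as \<open>C\<close>. This is used for \<open>M\<close>, to make the
  infimum of the Rayleigh quotient finite, and for the inverse of a shifted matrix.\<close>

lemma quadratic_form_bounded:
  fixes K :: "real mat"
  assumes K: "K \<in> carrier_mat n n"
  shows "\<exists>C. \<forall>x\<in>carrier_vec n. \<bar>x \<bullet> (K *\<^sub>v x)\<bar> \<le> C * (x \<bullet> x)"
proof (intro exI ballI)
  fix x :: "real vec"
  assume x: "x \<in> carrier_vec n"
  have prod: "\<bar>x $ i * x $ j\<bar> \<le> x \<bullet> x" if "i < n" "j < n" for i j
  proof -
    have sq: "(x $ i)\<^sup>2 \<le> x \<bullet> x" if "i < n" for i
      using x that unfolding scalar_prod_def power2_eq_square
      by (intro member_le_sum[of i _ "\<lambda>i. x $ i * x $ i"]) auto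
    have "0 \<le> (\<bar>x $ i\<bar> - \<bar>x $ j\<bar>)\<^sup>2"
      by simp
    then have "2 * \<bar>x $ i * x $ j\<bar> \<le> (x $ i)\<^sup>2 + (x $ j)\<^sup>2"
      by (simp add: power2_diff abs_mult)
    then show ?thesis
      using sq[OF that(1)] sq[OF that(2)] by linarith
  qed
  have "x \<bullet> (K *\<^sub>v x) = (\<Sum>i<n. \<Sum>j<n. K $$ (i, j) * (x $ i * x $ j))"
    using K x by (auto simp: scalar_prod_def atLeast0LessThan sum_distrib_left intro!: sum.cong)
  also have "\<bar>\<dots>\<bar> \<le> (\<Sum>i<n. \<Sum>j<n. \<bar>K $$ (i, j)\<bar> * (x \<bullet> x))"
    by (intro order_trans[OF sum_abs] sum_mono)
       (auto simp: abs_mult[of "K $$ _"] intro!: mult_left_mono prod)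
  finally show "\<bar>x \<bullet> (K *\<^sub>v x)\<bar> \<le> (\<Sum>i<n. \<Sum>j<n. \<bar>K $$ (i, j)\<bar>) * (x \<bullet> x)"
    by (simp add: sum_distrib_right)
qed

lemma char_matrix_mult_vec:
  fixes M :: "'a :: field mat"
  assumes "M \<in> carrier_mat n n" "x \<in> carrier_vec n"
  shows "char_matrix M e *\<^sub>v x = M *\<^sub>v x - e \<cdot>\<^sub>v x"
  using assms unfolding char_matrix_def
  by (intro eq_vecI) (auto simp: add_scalar_prod_distrib[of _ n])

text \<open>Take \<mu> as the infimum of the Rayleigh quotient. The form of
  \<open>M - \<mu> I\<close> is then nonnegative but comes arbitrarily close to 0 on the unit
  sphere. This rules out an inverse, so \<mu> is an eigenvalue.\<close>

lemma symmetric_mat_eigenvalue_lower: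
  fixes M :: "real mat"
  assumes M: "M \<in> carrier_mat n n" and sym: "transpose_mat M = M" and n: "0 < n"
  obtains \<mu> where "eigenvalue M \<mu>" "\<And>x. x \<in> carrier_vec n \<Longrightarrow> \<mu> * (x \<bullet> x) \<le> x \<bullet> (M *\<^sub>v x)"
proof -
  define R where "R = {x \<bullet> (M *\<^sub>v x) | x. x \<in> carrier_vec n \<and> x \<bullet> x = 1}"
  define \<mu> where "\<mu> = Inf R"
  define Q where "Q = char_matrix M \<mu>"
  obtain C where C: "\<And>x. x \<in> carrier_vec n \<Longrightarrow> \<bar>x \<bullet> (M *\<^sub>v x)\<bar> \<le> C * (x \<bullet> x)"
    using quadratic_form_bounded[OF M] by blast
  have "unit_vec n 0 \<bullet> unit_vec n 0 = (1 :: real)"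
    using n by simp
  then have R_ne: "R \<noteq> {}"
    unfolding R_def using unit_vec_carrier by blast
  have R_bdd: "bdd_below R"
    by (rule bdd_belowI[of _ "-C"]) (use C in \<open>fastforce simp: R_def\<close>)
  have lower: "\<mu> * (x \<bullet> x) \<le> x \<bullet> (M *\<^sub>v x)" if x: "x \<in> carrier_vec n" for x
  proof (cases "x = 0\<^sub>v n")
    case False
    define c where "c = 1 / sqrt (x \<bullet> x)"
    have pos: "0 < x \<bullet> x"
      using False x scalar_prod_self_eq_0_iff[OF x] scalar_prod_self_nonneg[of x] by linarith
    have cc: "c * c * (x \<bullet> x) = 1"
      using pos by (simp add: c_def)
    have "(c \<cdot>\<^sub>v x) \<bullet> (c \<cdot>\<^sub>v x) = 1"
      using cc x by (simp add: mult.assoc)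
    then have "(c \<cdot>\<^sub>v x) \<bullet> (M *\<^sub>v (c \<cdot>\<^sub>v x)) \<in> R"
      unfolding R_def using x by (intro CollectI exI[of _ "c \<cdot>\<^sub>v x"] conjI) auto
    then have "\<mu> \<le> (c \<cdot>\<^sub>v x) \<bullet> (M *\<^sub>v (c \<cdot>\<^sub>v x))"
      unfolding \<mu>_def by (rule cInf_lower[OF _ R_bdd])
    also have "\<dots> = c * c * (x \<bullet> (M *\<^sub>v x))"
      using x M by (simp add: mult_mat_vec[OF M x] mult.assoc)
    finally have "\<mu> * (x \<bullet> x) \<le> c * c * (x \<bullet> (M *\<^sub>v x)) * (x \<bullet> x)"
      by (rule mult_right_mono) simp
    also have "\<dots> = (c * c * (x \<bullet> x)) * (x \<bullet> (M *\<^sub>v x))"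
      by (simp only: mult_ac)
    finally show ?thesis
      by (simp add: cc)
  qed (use M in auto)
  have Q: "Q \<in> carrier_mat n n"
    using M by (simp add: Q_def)
  have Q_form: "x \<bullet> (Q *\<^sub>v y) = x \<bullet> (M *\<^sub>v y) - \<mu> * (x \<bullet> y)"
    if "x \<in> carrier_vec n" "y \<in> carrier_vec n" for x y
    using that M by (simp add: Q_def char_matrix_mult_vec[OF M] scalar_prod_minus_distrib[of _ n])
  have Q_sym: "x \<bullet> (Q *\<^sub>v y) = y \<bullet> (Q *\<^sub>v x)"
    if xy: "x \<in> carrier_vec n" "y \<in> carrier_vec n" for x y
  proof -
    have "x \<bullet> (M *\<^sub>v y) = y \<bullet> (M *\<^sub>v x)"
      using transpose_vec_mult_scalar[OF M xy(2,1)] comm_scalar_prod[of "M *\<^sub>v x" n y] M xy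
      by (simp add: sym)
    then show ?thesis
      using xy by (simp add: Q_form comm_scalar_prod[of x n y])
  qed
  have "det Q = 0"
  proof (rule ccontr)
    assume "det Q \<noteq> 0"
    from det_non_zero_imp_unit[OF Q this, of undefined]
    obtain K where K: "K \<in> carrier_mat n n" and QK: "Q * K = 1\<^sub>m n"
      by (auto simp: Units_def ring_mat_def)
    obtain C where C: "\<And>x. x \<in> carrier_vec n \<Longrightarrow> \<bar>x \<bullet> (K *\<^sub>v x)\<bar> \<le> C * (x \<bullet> x)"
      using quadratic_form_bounded[OF K] by blast
    \<comment> \<open>\<open>D\<close> is positive and at least \<open>C\<close>. With step length
      \<open>1 / D\<close> the second-order term then uses up at most half of the first-order gain
      \<open>2 / D\<close>.\<close>
    define D where "D = \<bar>C\<bar> + 1"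
    have D: "0 < D" "C \<le> D"
      by (auto simp: D_def)
    \<comment> \<open>Positivity of the form \<open>Q\<close> at \<open>x - (K x) / D\<close> makes \<open>Q\<close> uniformly positive on the
      unit sphere, so \<open>\<mu>\<close> would not be the infimum.\<close>
    have "\<mu> + 1 / D \<le> x \<bullet> (M *\<^sub>v x)" if x: "x \<in> carrier_vec n" and x1: "x \<bullet> x = 1" for x
    proof -
      define y where "y = K *\<^sub>v x"
      have y: "y \<in> carrier_vec n" and Qy: "Q *\<^sub>v y = x"
        using K x Q QK assoc_mult_mat_vec[OF Q K x] by (auto simp: y_def)
      define z where "z = x - (1 / D) \<cdot>\<^sub>v y"
      have z: "z \<in> carrier_vec n"
        using x y by (simp add: z_def)
      have "0 \<le> z \<bullet> (Q *\<^sub>v z)"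
        using lower[OF z] by (simp add: Q_form[OF z z])
      also have "Q *\<^sub>v z = Q *\<^sub>v x - (1 / D) \<cdot>\<^sub>v x"
        using Q x y by (simp add: z_def mult_minus_distrib_mat_vec[OF Q] mult_mat_vec[OF Q] Qy)
      also have "z \<bullet> \<dots> = x \<bullet> (Q *\<^sub>v x) - 1 / D * (x \<bullet> x)
          - 1 / D * (y \<bullet> (Q *\<^sub>v x)) + 1 / D * (1 / D * (y \<bullet> x))"
        using Q x y
        by (simp add: z_def minus_scalar_prod_distrib[of _ n] scalar_prod_minus_distrib[of _ n] algebra_simps)
      also have "y \<bullet> (Q *\<^sub>v x) = 1"
        using Q_sym[OF y x] x1 by (simp add: Qy)
      finally have "2 / D \<le> x \<bullet> (Q *\<^sub>v x) + 1 / D * (1 / D * (y \<bullet> x))"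
        by (simp add: x1)
      moreover have "y \<bullet> x \<le> D"
        using C[OF x] D x1 comm_scalar_prod[OF x y] by (simp add: y_def)
      then have "1 / D * (1 / D * (y \<bullet> x)) \<le> 1 / D * (1 / D * D)"
        using D by (intro mult_left_mono) auto
      moreover have "1 / D * (1 / D * D) = 1 / D" "2 / D = 1 / D + 1 / D"
        using D by auto
      ultimately have "1 / D \<le> x \<bullet> (Q *\<^sub>v x)"
        by linarith
      then show ?thesis
        by (simp add: Q_form[OF x x] x1)
    qed
    then have "\<mu> + 1 / D \<le> Inf R"
      using R_ne by (intro cInf_greatest) (auto simp: R_def)
    then show False
      using D by (simp add: \<mu>_def)
  qed
  then have "eigenvalue M \<mu>"
    using det_0_iff_vec_prod_zero[OF Q] by (simp add: eigenvalue_char_matrix[OF M] Q_def)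
  then show thesis
    using lower by (rule that)
qed

text \<open>Apply the lower bound to \<open>- M\<close> and change signs.\<close>

lemma symmetric_mat_eigenvalue_upper:
  fixes M :: "real mat"
  assumes M: "M \<in> carrier_mat n n" and sym: "transpose_mat M = M" and n: "0 < n"
  obtains \<nu> where "eigenvalue M \<nu>" "\<And>x. x \<in> carrier_vec n \<Longrightarrow> x \<bullet> (M *\<^sub>v x) \<le> \<nu> * (x \<bullet> x)"
proof -
  have "transpose_mat (- M) = - M"
    using arg_cong[OF sym, of uminus] by (simp add: transpose_uminus)
  then obtain \<mu> where ev: "eigenvalue (- M) \<mu>"
    and lower: "\<And>x. x \<in> carrier_vec n \<Longrightarrow> \<mu> * (x \<bullet> x) \<le> x \<bullet> (- M *\<^sub>v x)"
    using symmetric_mat_eigenvalue_lower[of "- M" n] M n by (metis uminus_carrier_iff_mat)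
  from ev obtain v where v: "v \<in> carrier_vec n" "v \<noteq> 0\<^sub>v n" "- M *\<^sub>v v = \<mu> \<cdot>\<^sub>v v"
    using M by (auto simp: eigenvalue_def eigenvector_def)
  have uminus: "- M *\<^sub>v x = - (M *\<^sub>v x)" if "x \<in> carrier_vec n" for x
    using M that by (intro eq_vecI) auto
  have "M *\<^sub>v v = (- \<mu>) \<cdot>\<^sub>v v"
    using arg_cong[OF v(3), of uminus] uminus[OF v(1)] by auto
  then have "eigenvalue M (- \<mu>)"
    using M v by (auto simp: eigenvalue_def eigenvector_def)
  moreover have "x \<bullet> (M *\<^sub>v x) \<le> - \<mu> * (x \<bullet> x)" if "x \<in> carrier_vec n" for x
    using lower[OF that] M that by (simp add: uminus)
  ultimately show thesis
    by (rule that)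
qed

text \<open>The form of the Gram matrix \<open>transpose_mat A * A\<close> is the squared norm of
  the image. The condition \<open>n \<le> m\<close> makes \<open>singular_values\<close> refer to
  this Gram matrix; a wide matrix has a nontrivial kernel even when its smallest singular value is
  positive.\<close>

lemma singular_value_bounds:
  assumes A: "A \<in> carrier_mat m n" and n: "0 < n" and nm: "n \<le> m"
    and x: "x \<in> carrier_vec n"
  shows sigma_min_le: "sigma_min A * l2norm x \<le> l2norm (A *\<^sub>v x)"
    and sigma_max_ge: "l2norm (A *\<^sub>v x) \<le> sigma_max A * l2norm x"
proof -
  define M where "M = transpose_mat A * A"
  have M: "M \<in> carrier_mat n n"
    using A by (simp add: M_def)
  have sym: "transpose_mat M = M"
    using transpose_mult[of "transpose_mat A" n m A n] A by (simp add: M_def)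
  have sv: "singular_values A = sqrt ` spectrum M"
    using A nm by (simp add: singular_values_def M_def)
  have fin: "finite (singular_values A)"
    unfolding sv using card_finite_spectrum(1)[OF M] by simp
  have form: "x \<bullet> (M *\<^sub>v x) = (A *\<^sub>v x) \<bullet> (A *\<^sub>v x)"
    using transpose_vec_mult_scalar[OF A x, of "A *\<^sub>v x"] A x
      comm_scalar_prod[of "transpose_mat A *\<^sub>v (A *\<^sub>v x)" n x]
      assoc_mult_mat_vec[of "transpose_mat A" n m A n x]
    by (simp add: M_def)
  obtain \<mu> where \<mu>: "eigenvalue M \<mu>" "\<mu> * (x \<bullet> x) \<le> x \<bullet> (M *\<^sub>v x)"
    using symmetric_mat_eigenvalue_lower[OF M sym n] x by metis
  have "sigma_min A \<le> sqrt \<mu>"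
    unfolding sigma_min_def using \<mu>(1) by (intro Min_le[OF fin]) (auto simp: sv spectrum_def)
  then have "sigma_min A * l2norm x \<le> sqrt \<mu> * l2norm x"
    by (intro mult_right_mono) auto
  \<comment> \<open>\<open>sqrt\<close> is monotone and multiplicative on all reals, so taking roots
    requires no sign information about \<mu>.\<close>
  also have "\<dots> \<le> l2norm (A *\<^sub>v x)"
    using \<mu>(2) by (simp add: l2norm_def form flip: real_sqrt_mult)
  finally show "sigma_min A * l2norm x \<le> l2norm (A *\<^sub>v x)" .
  obtain \<nu> where \<nu>: "eigenvalue M \<nu>" "x \<bullet> (M *\<^sub>v x) \<le> \<nu> * (x \<bullet> x)"
    using symmetric_mat_eigenvalue_upper[OF M sym n] x by metis
  have "l2norm (A *\<^sub>v x) \<le> sqrt \<nu> * l2norm x"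
    using \<nu>(2) by (simp add: l2norm_def form flip: real_sqrt_mult)
  also have "sqrt \<nu> \<le> sigma_max A"
    unfolding sigma_max_def using \<nu>(1) by (intro Max_ge[OF fin]) (auto simp: sv spectrum_def)
  then have "sqrt \<nu> * l2norm x \<le> sigma_max A * l2norm x"
    by (intro mult_right_mono) auto
  finally show "l2norm (A *\<^sub>v x) \<le> sigma_max A * l2norm x" .
qed

lemma sigma_max_nonneg:
  assumes "A \<in> carrier_mat m n" "0 < n" "n \<le> m"
  shows "0 \<le> sigma_max A"
proof -
  have "l2norm (unit_vec n 0) = 1"
    using assms by (simp add: l2norm_def)
  then show ?thesis
    using order_trans[OF l2norm_nonneg sigma_max_ge[OF assms, of "unit_vec n 0"]] by simp
qed

section \<open>Projection onto affine subspaces\<close>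

text \<open>Gram-Schmidt by induction on the number \<open>j\<close> of columns taken into account.
  Using only the first \<open>j\<close> columns is expressed by coefficients that vanish from index
  \<open>j\<close> on, so \<open>V\<close> itself stays fixed. The columns may be linearly
  dependent.\<close>

lemma ex_orthogonal_projection_column_span:
  fixes V :: "real mat"
  assumes V: "V \<in> carrier_mat m n" and "j \<le> n" and "x \<in> carrier_vec m"
  shows "\<exists>z\<in>carrier_vec n. (\<forall>i<n. j \<le> i \<longrightarrow> z $ i = 0) \<and>
           (\<forall>y\<in>carrier_vec n. (\<forall>i<n. j \<le> i \<longrightarrow> y $ i = 0) \<longrightarrow> (x - V *\<^sub>v z) \<bullet> (V *\<^sub>v y) = 0)"
  using assms(2,3)
proof (induction j arbitrary: x)
  case 0
  have "(x - V *\<^sub>v 0\<^sub>v n) \<bullet> (V *\<^sub>v y) = 0"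
    if "y \<in> carrier_vec n" "\<forall>i<n. 0 \<le> i \<longrightarrow> y $ i = 0" for y :: "real vec"
  proof -
    have "y = 0\<^sub>v n"
      using that by (intro eq_vecI) auto
    then have "V *\<^sub>v y = 0\<^sub>v m"
      using V by (intro eq_vecI) auto
    then show ?thesis
      using V 0 by simp
  qed
  then show ?case
    by (intro bexI[of _ "0\<^sub>v n"]) auto
next
  case (Suc j)
  define E where "E = {z \<in> carrier_vec n. \<forall>i<n. j \<le> i \<longrightarrow> z $ i = (0 :: real)}"
  have E_carrier: "z \<in> carrier_vec n" if "z \<in> E" for z
    using that by (simp add: E_def)
  define e where "e = (unit_vec n j :: real vec)"
  have e: "e \<in> carrier_vec n" and j: "j < n"
    using Suc.prems by (auto simp: e_def)
  have IH: "\<exists>z\<in>E. \<forall>y\<in>E. (x - V *\<^sub>v z) \<bullet> (V *\<^sub>v y) = 0" if "x \<in> carrier_vec m" for x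
    using Suc.IH[OF _ that] j unfolding E_def by auto
  obtain q where q: "q \<in> E" and q_orth: "\<And>y. y \<in> E \<Longrightarrow> (V *\<^sub>v e - V *\<^sub>v q) \<bullet> (V *\<^sub>v y) = 0"
    using IH[of "V *\<^sub>v e"] V e by auto
  obtain p where p: "p \<in> E" and p_orth: "\<And>y. y \<in> E \<Longrightarrow> (x - V *\<^sub>v p) \<bullet> (V *\<^sub>v y) = 0"
    using IH[OF Suc.prems(2)] by auto
  \<comment> \<open>\<open>v\<close> is the part of the new column that is orthogonal to the span of
    the earlier ones.\<close>
  define v where "v = V *\<^sub>v (e - q)"
  have v: "v \<in> carrier_vec m"
    using V e q E_carrier by (simp add: v_def)
  have v_orth: "v \<bullet> (V *\<^sub>v y) = 0" if "y \<in> E" for y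
    using q_orth[OF that] V e q E_carrier by (simp add: v_def mult_minus_distrib_mat_vec[OF V])
  \<comment> \<open>Entry \<open>j\<close> of \<open>q\<close> is 0, so entry \<open>j\<close> of
    \<open>e - q\<close> is 1, and subtracting \<open>y $ j\<close> times this vector leads back
    into \<open>E\<close>.\<close>
  have split: "\<exists>y'\<in>E. \<exists>c. y = y' + c \<cdot>\<^sub>v (e - q)"
    if y: "y \<in> carrier_vec n" "\<forall>i<n. Suc j \<le> i \<longrightarrow> y $ i = 0" for y
  proof (intro bexI exI)
    show "y = (y - y $ j \<cdot>\<^sub>v (e - q)) + y $ j \<cdot>\<^sub>v (e - q)"
      using y e E_carrier[OF q] by (intro eq_vecI) auto
    show "y - y $ j \<cdot>\<^sub>v (e - q) \<in> E"
      using y e q j by (auto simp: E_def e_def le_eq_less_or_eq Suc_le_eq)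
  qed
  \<comment> \<open>If \<open>v = 0\<close>, the coefficient is \<open>0\<close> by the convention on division.\<close>
  define c where "c = (x - V *\<^sub>v p) \<bullet> v / (v \<bullet> v)"
  define z where "z = p + c \<cdot>\<^sub>v (e - q)"
  have z: "z \<in> carrier_vec n" "\<forall>i<n. Suc j \<le> i \<longrightarrow> z $ i = 0"
    using p q e j by (auto simp: z_def E_def e_def)
  have Vz: "V *\<^sub>v z = V *\<^sub>v p + c \<cdot>\<^sub>v v"
    using p q e E_carrier V
    by (simp add: z_def v_def mult_add_distrib_mat_vec[OF V] mult_mat_vec[OF V])
  have x: "x \<in> carrier_vec m" and Vp: "V *\<^sub>v p \<in> carrier_vec m"
    using Suc.prems V p E_carrier by auto
  have res: "(x - V *\<^sub>v z) \<bullet> w = (x - V *\<^sub>v p) \<bullet> w - c * (v \<bullet> w)" if w: "w \<in> carrier_vec m" for w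
  proof -
    have "x - V *\<^sub>v z = (x - V *\<^sub>v p) - c \<cdot>\<^sub>v v"
      unfolding Vz using x v V by (intro eq_vecI) auto
    then show ?thesis
      using x Vp v w minus_scalar_prod_distrib[of "x - V *\<^sub>v p" m "c \<cdot>\<^sub>v v" w] by simp
  qed
  have res_v: "(x - V *\<^sub>v z) \<bullet> v = 0"
    using v scalar_prod_self_eq_0_iff[OF v] x Vp by (auto simp: res[OF v] c_def)
  have "(x - V *\<^sub>v z) \<bullet> (V *\<^sub>v y) = 0"
    if y: "y \<in> carrier_vec n" "\<forall>i<n. Suc j \<le> i \<longrightarrow> y $ i = 0" for y
  proof -
    obtain y' d where y': "y' \<in> E" and y_eq: "y = y' + d \<cdot>\<^sub>v (e - q)"
      using split[OF y] by blast
    have Vy': "V *\<^sub>v y' \<in> carrier_vec m"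
      using V y' E_carrier by simp
    have "V *\<^sub>v y = V *\<^sub>v y' + d \<cdot>\<^sub>v v"
      using y' q e E_carrier V
      by (simp add: y_eq v_def mult_add_distrib_mat_vec[OF V] mult_mat_vec[OF V])
    then have "(x - V *\<^sub>v z) \<bullet> (V *\<^sub>v y) = (x - V *\<^sub>v z) \<bullet> (V *\<^sub>v y') + d * ((x - V *\<^sub>v z) \<bullet> v)"
      using x V z v Vy' by (simp add: scalar_prod_add_distrib[of _ m])
    also have "\<dots> = 0"
      using res[OF Vy'] p_orth[OF y'] v_orth[OF y'] res_v by simp
    finally show ?thesis .
  qed
  then show ?case
    using z by blast
qed

text \<open>Pythagoras at the foot \<open>q\<close> of the perpendicular shows that \<open>q\<close>
  is the only minimizer, hence the value of \<open>l2_proj\<close>. Dropping one of its two squares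
  gives the distance bound, which is nonexpansiveness against a point \<open>w\<close> fixed by the
  projection.\<close>

lemma l2_proj_affine:
  assumes V: "V \<in> carrier_mat m n" and x0: "x0 \<in> carrier_vec m" and u: "u \<in> carrier_vec m"
    and S: "S = {x0 + V *\<^sub>v z | z. z \<in> carrier_vec n}"
  shows l2_proj_affine_mem: "l2_proj S u \<in> S"
    and l2_proj_affine_dist: "w \<in> S \<Longrightarrow> l2norm (w - l2_proj S u) \<le> l2norm (w - u)"
proof -
  obtain z where z: "z \<in> carrier_vec n"
    and orth: "\<And>y. y \<in> carrier_vec n \<Longrightarrow> (u - x0 - V *\<^sub>v z) \<bullet> (V *\<^sub>v y) = 0"
    using ex_orthogonal_projection_column_span[OF V order_refl, of "u - x0"] u x0 by auto
  define q where "q = x0 + V *\<^sub>v z"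
  have q: "q \<in> carrier_vec m" "q \<in> S"
    using V x0 z by (auto simp: q_def S)
  have pyth: "(l2norm (w - u))\<^sup>2 = (l2norm (w - q))\<^sup>2 + (l2norm (q - u))\<^sup>2" if "w \<in> S" for w
  proof -
    obtain y where y: "y \<in> carrier_vec n" and w_eq: "w = x0 + V *\<^sub>v y"
      using \<open>w \<in> S\<close> by (auto simp: S)
    have w: "w \<in> carrier_vec m"
      using V x0 y by (simp add: w_eq)
    have "w - q = V *\<^sub>v (y - z)"
      using V x0 y z unfolding w_eq q_def mult_minus_distrib_mat_vec[OF V y z] by (intro eq_vecI) auto
    moreover have "u - q = u - x0 - V *\<^sub>v z"
      using V x0 u z unfolding q_def by (intro eq_vecI) auto
    ultimately have "(u - q) \<bullet> (w - q) = 0"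
      using orth[of "y - z"] y z by simp
    moreover have "w - u = (w - q) - (u - q)" "q - u = - (u - q)"
      using w u q by (auto intro!: eq_vecI)
    ultimately show ?thesis
      using w u q comm_scalar_prod[of "u - q" m "w - q"] unfolding l2norm_power2
      by (simp add: minus_scalar_prod_distrib[of _ m] scalar_prod_minus_distrib[of _ m])
  qed
  have carrier: "w \<in> carrier_vec m" if "w \<in> S" for w
    using that V x0 by (auto simp: S)
  have "l2norm (u - q) \<le> l2norm (u - w)" if "w \<in> S" for w
  proof -
    have "(l2norm (q - u))\<^sup>2 \<le> (l2norm (w - u))\<^sup>2"
      using pyth[OF that] by simp
    then show ?thesis
      using q u carrier[OF that] by (simp add: l2norm_minus_commute[of u m] abs_le_square_iff[symmetric])
  qed
  then have "is_arg_min (\<lambda>w. l2norm (u - w)) (\<lambda>w. w \<in> S) q"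
    using q by (auto simp: is_arg_min_def not_less)
  \<comment> \<open>Since a minimizer exists, the choice operator returns one; that it equals
    \<open>q\<close> follows below.\<close>
  then have am: "is_arg_min (\<lambda>w. l2norm (u - w)) (\<lambda>w. w \<in> S) (l2_proj S u)"
    unfolding l2_proj_def arg_min_def by (rule someI)
  then show p: "l2_proj S u \<in> S"
    by (simp add: is_arg_min_def)
  define p where "p = l2_proj S u"
  have pS: "p \<in> S" and pc: "p \<in> carrier_vec m"
    using p carrier by (auto simp: p_def)
  \<comment> \<open>With Pythagoras for \<open>p\<close>, this inequality leaves no room for a
    nonzero \<open>p - q\<close>.\<close>
  have "l2norm (p - u) \<le> l2norm (q - u)"
    using am q u pc by (auto simp: is_arg_min_def p_def[symmetric] l2norm_minus_commute[of u m] not_less)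
  then have "(l2norm (p - u))\<^sup>2 \<le> (l2norm (q - u))\<^sup>2"
    by (intro power_mono) auto
  then have "(p - q) \<bullet> (p - q) \<le> 0"
    using pyth[OF pS] by (simp add: l2norm_power2)
  then have pq: "p - q = 0\<^sub>v m"
    using scalar_prod_self_eq_0_iff[of "p - q" m] scalar_prod_self_nonneg[of "p - q"] pc q
    by (simp add: order_antisym)
  have "p = (p - q) + q"
    using pc q by auto
  then have "p = q"
    using q by (simp add: pq)
  moreover assume "w \<in> S"
  then have "(l2norm (w - q))\<^sup>2 \<le> (l2norm (w - u))\<^sup>2"
    using pyth by simp
  ultimately show "l2norm (w - l2_proj S u) \<le> l2norm (w - u)"
    by (simp add: abs_le_square_iff[symmetric] p_def)
qed

section \<open>The windowed residual\<close>

text \<open>Reverse triangle inequality. In the application \<open>d\<close> is a difference of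
  window states and \<open>g\<close> the corresponding difference of right-hand sides.\<close>

lemma l2norm_affine_lower:
  assumes A: "A \<in> carrier_mat m n" and B: "B \<in> carrier_mat m n" and n: "0 < n" "n \<le> m"
    and d: "d \<in> carrier_vec n" and g: "g \<in> carrier_vec n"
    and dt: "0 \<le> dt" and g_le: "l2norm g \<le> \<kappa> * l2norm d"
  shows "(sigma_min A - sigma_max B * dt * \<kappa>) * l2norm d \<le> l2norm (A *\<^sub>v d - dt \<cdot>\<^sub>v (B *\<^sub>v g))"
proof -
  have car: "A *\<^sub>v d \<in> carrier_vec m" "dt \<cdot>\<^sub>v (B *\<^sub>v g) \<in> carrier_vec m"
    using A B d g by auto
  have "A *\<^sub>v d = (A *\<^sub>v d - dt \<cdot>\<^sub>v (B *\<^sub>v g)) + dt \<cdot>\<^sub>v (B *\<^sub>v g)"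
    using A B by (intro eq_vecI) auto
  then have "l2norm (A *\<^sub>v d) \<le> l2norm (A *\<^sub>v d - dt \<cdot>\<^sub>v (B *\<^sub>v g)) + l2norm (dt \<cdot>\<^sub>v (B *\<^sub>v g))"
    using l2norm_add_le[of "A *\<^sub>v d - dt \<cdot>\<^sub>v (B *\<^sub>v g)" m "dt \<cdot>\<^sub>v (B *\<^sub>v g)"] car by simp
  moreover have "l2norm (dt \<cdot>\<^sub>v (B *\<^sub>v g)) \<le> dt * (sigma_max B * (\<kappa> * l2norm d))"
    unfolding l2norm_smult abs_of_nonneg[OF dt]
    by (intro mult_left_mono[OF _ dt] order_trans[OF sigma_max_ge[OF B n g]] mult_left_mono[OF g_le]
        sigma_max_nonneg[OF B n])
  ultimately show ?thesis
    using sigma_min_le[OF A n d] by (simp add: algebra_simps)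
qed

lemma l2norm_affine_upper:
  assumes A: "A \<in> carrier_mat m n" and B: "B \<in> carrier_mat m n" and n: "0 < n" "n \<le> m"
    and d: "d \<in> carrier_vec n" and g: "g \<in> carrier_vec n"
    and dt: "0 \<le> dt" and g_le: "l2norm g \<le> \<kappa> * l2norm d"
  shows "l2norm (A *\<^sub>v d - dt \<cdot>\<^sub>v (B *\<^sub>v g)) \<le> (sigma_max A + dt * \<kappa> * sigma_max B) * l2norm d"
proof -
  have "l2norm (A *\<^sub>v d - dt \<cdot>\<^sub>v (B *\<^sub>v g)) \<le> l2norm (A *\<^sub>v d) + l2norm (dt \<cdot>\<^sub>v (B *\<^sub>v g))"
    using A B d g by (intro l2norm_minus_le[of _ m]) auto
  moreover have "l2norm (dt \<cdot>\<^sub>v (B *\<^sub>v g)) \<le> dt * (sigma_max B * (\<kappa> * l2norm d))"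
    unfolding l2norm_smult abs_of_nonneg[OF dt]
    by (intro mult_left_mono[OF _ dt] order_trans[OF sigma_max_ge[OF B n g]] mult_left_mono[OF g_le]
        sigma_max_nonneg[OF B n])
  ultimately show ?thesis
    using sigma_max_ge[OF A n d] by (simp add: algebra_simps)
qed

lemma affine_diff:
  fixes A B :: "real mat"
  assumes A: "A \<in> carrier_mat m n" and B: "B \<in> carrier_mat m n"
    and "x \<in> carrier_vec n" "y \<in> carrier_vec n" "g \<in> carrier_vec n" "h \<in> carrier_vec n"
  shows "(A *\<^sub>v x - c \<cdot>\<^sub>v (B *\<^sub>v g)) - (A *\<^sub>v y - c \<cdot>\<^sub>v (B *\<^sub>v h)) = A *\<^sub>v (x - y) - c \<cdot>\<^sub>v (B *\<^sub>v (g - h))"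
  unfolding mult_minus_distrib_mat_vec[OF A assms(3,4)] mult_minus_distrib_mat_vec[OF B assms(5,6)]
  using assms by (intro eq_vecI) (auto simp: algebra_simps)

section \<open>Blocks and stacked vectors\<close>

lemma block_carrier [simp]: "block m w l \<in> carrier_vec m"
  by (simp add: block_def)

lemma stack_carrier [simp]: "stack m L g \<in> carrier_vec (m * L)"
  by (simp add: stack_def)

lemma div_less_of_less_mult: "p < m * L \<Longrightarrow> p div m < L" for p m L :: nat
  by (simp add: less_mult_imp_div_less mult.commute)

lemma mod_less_of_less_mult: "p < m * L \<Longrightarrow> p mod m < m" for p m L :: nat
  by (auto intro!: mod_less_divisor gr0I)

lemma stack_block: "w \<in> carrier_vec (m * L) \<Longrightarrow> stack m L (block m w) = w"
  by (intro eq_vecI) (auto simp: stack_def block_def mod_less_of_less_mult)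

text \<open>Division with remainder turns an entry index into a pair of block and position; here
  blocks are counted from 0.\<close>

lemma sum_div_mod:
  fixes h :: "nat \<Rightarrow> nat \<Rightarrow> 'a :: comm_monoid_add"
  shows "(\<Sum>q<m * L. h (q div m) (q mod m)) = (\<Sum>l<L. \<Sum>i<m. h l i)"
proof -
  have "(\<Sum>q\<in>{l * m..<l * m + m}. h (q div m) (q mod m)) = (\<Sum>i<m. h l i)" for l
    by (rule sum.reindex_bij_witness[of _ "\<lambda>i. l * m + i" "\<lambda>q. q - l * m"])
       (auto simp: mult.commute modulo_nat_def div_nat_eqI[of m l])
  then show ?thesis
    using sum.nat_group[of "\<lambda>q. h (q div m) (q mod m)" m L] by (simp add: mult.commute)
qed

lemma l2norm_stack:
  assumes "\<And>l. l \<in> {1..L} \<Longrightarrow> g l \<in> carrier_vec m"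
  shows "(l2norm (stack m L g))\<^sup>2 = (\<Sum>l<L. (l2norm (g (Suc l)))\<^sup>2)"
proof -
  have "(l2norm (stack m L g))\<^sup>2 = (\<Sum>q<m * L. (g (q div m + 1) $ (q mod m))\<^sup>2)"
    unfolding l2norm_power2 by (simp add: scalar_prod_def stack_def power2_eq_square atLeast0LessThan)
  also have "\<dots> = (\<Sum>l<L. \<Sum>i<m. (g (l + 1) $ i)\<^sup>2)"
    by (rule sum_div_mod[of "\<lambda>l i. (g (l + 1) $ i)\<^sup>2"])
  also have "\<dots> = (\<Sum>l<L. (l2norm (g (Suc l)))\<^sup>2)"
    unfolding l2norm_power2 using carrier_vecD[OF assms]
    by (intro sum.cong refl) (simp add: scalar_prod_def power2_eq_square atLeast0LessThan)
  finally show ?thesis .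
qed

text \<open>Squared norms add up over the blocks, so a constant common to all blocks survives
  stacking. This carries the Lipschitz constant of \<open>f\<close> over to the stacked right-hand
  side.\<close>

lemma l2norm_stack_mono:
  assumes g: "\<And>l. l \<in> {1..L} \<Longrightarrow> g l \<in> carrier_vec m" and h: "\<And>l. l \<in> {1..L} \<Longrightarrow> h l \<in> carrier_vec m"
    and le: "\<And>l. l \<in> {1..L} \<Longrightarrow> l2norm (g l) \<le> \<kappa> * l2norm (h l)" and \<kappa>: "0 \<le> \<kappa>"
  shows "l2norm (stack m L g) \<le> \<kappa> * l2norm (stack m L h)"
proof (rule power2_le_imp_le)
  have "(\<Sum>l<L. (l2norm (g (Suc l)))\<^sup>2) \<le> (\<Sum>l<L. (\<kappa> * l2norm (h (Suc l)))\<^sup>2)"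
    by (intro sum_mono power_mono le) auto
  then show "(l2norm (stack m L g))\<^sup>2 \<le> (\<kappa> * l2norm (stack m L h))\<^sup>2"
    using l2norm_stack[OF g] l2norm_stack[OF h] by (simp add: power_mult_distrib sum_distrib_left)
qed (use \<kappa> in simp)

lemma stack_diff:
  assumes "\<And>l. l \<in> {1..L} \<Longrightarrow> h l \<in> carrier_vec m"
  shows "stack m L g - stack m L h = stack m L (\<lambda>l. g l - h l)"
proof (intro eq_vecI)
  fix i assume "i < dim_vec (stack m L (\<lambda>l. g l - h l))"
  then have i: "i < m * L"
    by (simp add: stack_def)
  then have "dim_vec (h (i div m + 1)) = m"
    using assms[of "i div m + 1"] div_less_of_less_mult[OF i] by simp
  then show "(stack m L g - stack m L h) $ i = stack m L (\<lambda>l. g l - h l) $ i"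
    using i mod_less_of_less_mult[OF i] by (simp add: stack_def)
qed (simp add: stack_def)

section \<open>Matrix form of the windowed residual\<close>

lemma window_mat_carrier [simp]: "window_mat Ns s Nt c k \<in> carrier_mat (Ns * Nt k) (Ns * Nt k)"
  by (simp add: window_mat_def)

lemma window_mat0_carrier [simp]: "window_mat0 Ns s Nt c k \<in> carrier_mat (Ns * Nt k) Ns"
  by (simp add: window_mat0_def)

lemma dim_window_mat [simp]:
  "dim_row (window_mat Ns s Nt c k) = Ns * Nt k" "dim_col (window_mat Ns s Nt c k) = Ns * Nt k"
  "dim_row (window_mat0 Ns s Nt c k) = Ns * Nt k" "dim_col (window_mat0 Ns s Nt c k) = Ns"
  by (simp_all add: window_mat_def window_mat0_def)

text \<open>Index 0 of \<open>g\<close> belongs to the starting state. The stencil terms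
  \<open>j < l\<close> come from the square matrix and the term \<open>j = l\<close> from the tall
  one. Taking states with \<alpha> and right-hand sides with \<beta> covers both halves of the
  residual.\<close>

lemma window_mat_mult_stack:
  assumes p: "p < Ns * Nt k" and g0: "g 0 \<in> carrier_vec Ns"
    and l: "l = p div Ns + 1" and n: "n = theta Nt k + l - 1" and s_le: "s n \<le> l"
  shows "(window_mat Ns s Nt c k *\<^sub>v stack Ns (Nt k) g) $ p + (window_mat0 Ns s Nt c k *\<^sub>v g 0) $ p
           = (\<Sum>j\<le>s n. c n j * g (l - j) $ (p mod Ns))"
proof -
  define i where "i = p mod Ns"
  have i: "i < Ns"
    using mod_less_of_less_mult[OF p] by (simp add: i_def)
  have lL: "l \<le> Nt k"
    using div_less_of_less_mult[OF p] by (simp add: l)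
  \<comment> \<open>Extending the stencil terms by 0 makes the range of summation independent of
    \<open>s n\<close>.\<close>
  define G where "G j = (if j \<le> s n then c n j * g (l - j) $ i else 0)" for j
  have "(window_mat Ns s Nt c k *\<^sub>v stack Ns (Nt k) g) $ p
      = (\<Sum>q<Ns * Nt k. window_mat Ns s Nt c k $$ (p, q) * g (q div Ns + 1) $ (q mod Ns))"
    using p by (simp add: scalar_prod_def stack_def atLeast0LessThan window_mat_def)
  also have "\<dots> = (\<Sum>q<Ns * Nt k. if i = q mod Ns then if q div Ns < l then G (l - Suc (q div Ns)) else 0 else 0)"
    using p by (intro sum.cong refl) (auto simp: window_mat_def Let_def i_def G_def l n Suc_le_eq)
  also have "\<dots> = (\<Sum>m<Nt k. \<Sum>i'<Ns. if i = i' then if m < l then G (l - Suc m) else 0 else 0)"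
    by (rule sum_div_mod[of "\<lambda>m i'. if i = i' then if m < l then G (l - Suc m) else 0 else 0"])
  also have "\<dots> = (\<Sum>m<Nt k. if m < l then G (l - Suc m) else 0)"
    using i by simp
  also have "\<dots> = (\<Sum>m<l. G (l - Suc m))"
    using lL by (intro sum.mono_neutral_cong_right) auto
  also have "\<dots> = (\<Sum>j<l. G j)"
    by (rule sum.nat_diff_reindex)
  finally have 1: "(window_mat Ns s Nt c k *\<^sub>v stack Ns (Nt k) g) $ p = (\<Sum>j<l. G j)" .
  have "(window_mat0 Ns s Nt c k *\<^sub>v g 0) $ p = (\<Sum>q<Ns. window_mat0 Ns s Nt c k $$ (p, q) * g 0 $ q)"
    using p g0 by (simp add: scalar_prod_def atLeast0LessThan window_mat0_def)
  also have "\<dots> = (\<Sum>q<Ns. if i = q then if s n = l then c n l * g 0 $ q else 0 else 0)"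
    using p by (intro sum.cong refl) (auto simp: window_mat0_def Let_def i_def l n)
  also have "\<dots> = G l"
    using i s_le by (auto simp: G_def)
  finally have 2: "(window_mat0 Ns s Nt c k *\<^sub>v g 0) $ p = G l" .
  have "(\<Sum>j<l. G j) + G l = (\<Sum>j\<le>l. G j)"
    by (simp add: lessThan_Suc_atMost[symmetric])
  also have "\<dots> = (\<Sum>j\<le>s n. c n j * g (l - j) $ i)"
    using s_le by (intro sum.mono_neutral_cong_right) (auto simp: G_def)
  finally show ?thesis
    by (simp add: 1 2 i_def)
qed

text \<open>The stacked right-hand side, written with a bar over \<open>f\<close> in the paper.\<close>

definition window_rhs ::
  "nat \<Rightarrow> (real vec \<Rightarrow> real \<Rightarrow> real vec) \<Rightarrow> (nat \<Rightarrow> real) \<Rightarrow> (nat \<Rightarrow> nat) \<Rightarrow> nat \<Rightarrow> real vec \<Rightarrow> real vec" where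
  "window_rhs Ns f t Nt k w = stack Ns (Nt k) (\<lambda>l. f (block Ns w l) (t (theta Nt k + l - 1)))"

lemma window_rhs_carrier [simp]: "window_rhs Ns f t Nt k w \<in> carrier_vec (Ns * Nt k)"
  by (simp add: window_rhs_def)

lemma window_residual_carrier [simp]:
  "window_residual Ns f t dt s \<alpha> \<beta> Nt k w w0 \<in> carrier_vec (Ns * Nt k)"
  by (simp add: window_residual_def)

lemma window_residual_matrix_form:
  assumes w: "w \<in> carrier_vec (Ns * Nt k)" and w0: "w0 \<in> carrier_vec Ns"
    and f0: "f w0 (t (theta Nt k - 1)) \<in> carrier_vec Ns"
    and stencil: "\<And>l. l \<in> {1..Nt k} \<Longrightarrow> s (theta Nt k + l - 1) \<le> l"
  shows "window_residual Ns f t dt s \<alpha> \<beta> Nt k w w0 =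
      (window_mat Ns s Nt \<alpha> k *\<^sub>v w - dt \<cdot>\<^sub>v (window_mat Ns s Nt \<beta> k *\<^sub>v window_rhs Ns f t Nt k w))
    + (window_mat0 Ns s Nt \<alpha> k *\<^sub>v w0 - dt \<cdot>\<^sub>v (window_mat0 Ns s Nt \<beta> k *\<^sub>v f w0 (t (theta Nt k - 1))))"
    (is "_ = ?r")
proof (intro eq_vecI)
  fix p assume "p < dim_vec ?r"
  then have p: "p < Ns * Nt k"
    by simp
  define i l n where "i = p mod Ns" and "l = p div Ns + 1" and "n = theta Nt k + l - 1"
  have i: "i < Ns"
    using mod_less_of_less_mult[OF p] by (simp add: i_def)
  have s_le: "s n \<le> l"
    using stencil[of l] div_less_of_less_mult[OF p] by (simp add: n_def l_def)
  define X where "X m = (if m = 0 then w0 else block Ns w m)" for m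
  define F where "F m = f (X m) (t (theta Nt k + m - 1))" for m
  \<comment> \<open>By \<open>s_le\<close> the stencil stays at or after the starting state, so the
    truncated subtractions are exact.\<close>
  have st: "window_state Ns Nt k w w0 (n - j) = X (l - j)" "theta Nt k + (l - j) - 1 = n - j"
    if "j \<le> s n" for j
    using that s_le by (auto simp: window_state_def X_def n_def theta_def l_def)
  have X: "stack Ns (Nt k) X = w"
    using stack_block[OF w] by (simp add: stack_def X_def)
  have F: "stack Ns (Nt k) F = window_rhs Ns f t Nt k w"
    by (simp add: window_rhs_def stack_def F_def X_def)
  have 1: "window_residual Ns f t dt s \<alpha> \<beta> Nt k w w0 $ p
      = lmm_residual Ns f t dt s \<alpha> \<beta> n (window_state Ns Nt k w w0) $ i"
    using p by (simp add: window_residual_def stack_def i_def l_def n_def)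
  have "window_residual Ns f t dt s \<alpha> \<beta> Nt k w w0 $ p
      = (\<Sum>j\<le>s n. \<alpha> n j * X (l - j) $ i) - dt * (\<Sum>j\<le>s n. \<beta> n j * F (l - j) $ i)"
    using i unfolding 1 by (simp add: lmm_residual_def F_def st(1) st(2)[unfolded One_nat_def])
  also have "(\<Sum>j\<le>s n. \<alpha> n j * X (l - j) $ i)
      = (window_mat Ns s Nt \<alpha> k *\<^sub>v w) $ p + (window_mat0 Ns s Nt \<alpha> k *\<^sub>v w0) $ p"
    using window_mat_mult_stack[where Nt = Nt and k = k and s = s and g = X and c = \<alpha>,
        OF p _ l_def n_def s_le] w0 by (simp add: X i_def) (simp add: X_def)
  also have "(\<Sum>j\<le>s n. \<beta> n j * F (l - j) $ i)
      = (window_mat Ns s Nt \<beta> k *\<^sub>v window_rhs Ns f t Nt k w) $ p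
        + (window_mat0 Ns s Nt \<beta> k *\<^sub>v f w0 (t (theta Nt k - 1))) $ p"
    using window_mat_mult_stack[where Nt = Nt and k = k and s = s and g = F and c = \<beta>,
        OF p _ l_def n_def s_le] f0 by (simp add: F i_def) (simp add: F_def X_def)
  finally show "window_residual Ns f t dt s \<alpha> \<beta> Nt k w w0 $ p = ?r $ p"
    using p by (simp add: distrib_left del: index_mult_mat_vec)
qed (simp add: window_residual_def stack_def)

lemma window_rhs_lipschitz:
  assumes w: "w \<in> carrier_vec (Ns * Nt k)" and y: "y \<in> carrier_vec (Ns * Nt k)"
    and f: "\<And>x l. x \<in> carrier_vec Ns \<Longrightarrow> l \<in> {1..Nt k} \<Longrightarrow> f x (t (theta Nt k + l - 1)) \<in> carrier_vec Ns"
    and lip: "\<And>x z l. x \<in> carrier_vec Ns \<Longrightarrow> z \<in> carrier_vec Ns \<Longrightarrow> l \<in> {1..Nt k} \<Longrightarrow>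
        l2norm (f x (t (theta Nt k + l - 1)) - f z (t (theta Nt k + l - 1))) \<le> \<kappa> * l2norm (x - z)"
    and \<kappa>: "0 \<le> \<kappa>"
  shows "l2norm (window_rhs Ns f t Nt k w - window_rhs Ns f t Nt k y) \<le> \<kappa> * l2norm (w - y)"
proof -
  have "w - y = stack Ns (Nt k) (\<lambda>l. block Ns w l - block Ns y l)"
    using stack_diff[of "Nt k" "block Ns y" Ns "block Ns w"] by (simp add: stack_block w y)
  moreover have "window_rhs Ns f t Nt k w - window_rhs Ns f t Nt k y
      = stack Ns (Nt k) (\<lambda>l. f (block Ns w l) (t (theta Nt k + l - 1)) - f (block Ns y l) (t (theta Nt k + l - 1)))"
    unfolding window_rhs_def by (intro stack_diff f) auto
  ultimately show ?thesis
    using f lip \<kappa> by (auto intro!: l2norm_stack_mono)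
qed

text \<open>Extracting a block keeps the rows of \<open>V\<close> that belong to it, so the image is
  again affine and \<open>l2_proj_affine\<close> applies to the projection of starting
  states.\<close>

lemma block_trial_space:
  assumes V: "V \<in> carrier_mat (Ns * L) n" and x0: "x0 \<in> carrier_vec Ns" and l: "l \<in> {1..L}"
  shows "(\<lambda>w. block Ns w l) ` trial_space Ns L V x0
      = {x0 + mat Ns n (\<lambda>(i, q). V $$ ((l - 1) * Ns + i, q)) *\<^sub>v z | z. z \<in> carrier_vec n}"
proof -
  let ?V = "mat Ns n (\<lambda>(i, q). V $$ ((l - 1) * Ns + i, q))"
  have "block Ns (stack Ns L (\<lambda>_. x0) + V *\<^sub>v z) l = x0 + ?V *\<^sub>v z" if z: "z \<in> carrier_vec n" for z
  proof (intro eq_vecI)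
    fix i assume "i < dim_vec (x0 + ?V *\<^sub>v z)"
    then have i: "i < Ns"
      by simp
    have "(l - 1) * Ns + i < l * Ns"
      using i l by (cases l) auto
    also have "l * Ns \<le> Ns * L"
      using l by simp
    finally have idx: "(l - 1) * Ns + i < Ns * L" .
    then show "block Ns (stack Ns L (\<lambda>_. x0) + V *\<^sub>v z) l $ i = (x0 + ?V *\<^sub>v z) $ i"
      using i V z by (simp add: block_def stack_def scalar_prod_def)
  qed (simp add: block_def)
  then show ?thesis
    using V by (fastforce simp: trial_space_def image_iff)
qed

section \<open>The a priori error bound over one window\<close>

theorem theorem6p3:
  fixes Ns N Nw k :: nat
    and T dt \<kappa> a b :: real
    and f :: "real vec \<Rightarrow> real \<Rightarrow> real vec"
    and u_init :: "real vec"
    and t :: "nat \<Rightarrow> real"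
    and s Nt nb :: "nat \<Rightarrow> nat"
    and \<alpha> \<beta> :: "nat \<Rightarrow> nat \<Rightarrow> real"
    and u u0 ut ut0 :: "nat \<Rightarrow> real vec"
    and V :: "nat \<Rightarrow> real mat"
    and S :: "nat \<Rightarrow> real vec set"
    and Pu Pu0 :: "real vec"
  assumes Ns_pos: "0 < Ns"
    and f_carrier: "\<And>x \<tau>. x \<in> carrier_vec Ns \<Longrightarrow> \<tau> \<in> {0..T} \<Longrightarrow> f x \<tau> \<in> carrier_vec Ns"
    and u_init_carrier: "u_init \<in> carrier_vec Ns"
    \<comment> \<open>time grid and linear multistep scheme\<close>
    and dt_pos: "0 < dt"
    and t_step: "\<And>n. n < N \<Longrightarrow> t (Suc n) = t n + dt"
    and t_range: "\<And>n. n \<le> N \<Longrightarrow> t n \<in> {0..T}"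
    and alpha_nz: "\<And>n. n \<in> {1..N} \<Longrightarrow> \<alpha> n 0 \<noteq> 0"
    and alpha_sum: "\<And>n. n \<in> {1..N} \<Longrightarrow> (\<Sum>j\<le>s n. \<alpha> n j) = 0"
    \<comment> \<open>windows\<close>
    and Nt_pos: "\<And>j. j < Nw \<Longrightarrow> 0 < Nt j"
    and Nt_sum: "(\<Sum>j<Nw. Nt j) = N"
    and stencil_first: "\<And>j. j < Nw \<Longrightarrow> s (theta Nt j) = 1"
    and stencil: "\<And>j l. j < Nw \<Longrightarrow> l \<in> {1..Nt j} \<Longrightarrow> s (theta Nt j + l - 1) \<le> l"
    \<comment> \<open>full-order solution\<close>
    and u_carrier: "\<And>j. j < Nw \<Longrightarrow> u j \<in> carrier_vec (Ns * Nt j)"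
    and u0_init: "u0 0 = u_init"
    and u0_Suc: "\<And>j. Suc j < Nw \<Longrightarrow> u0 (Suc j) = block Ns (u j) (Nt j)"
    and full_order: "\<And>j. j < Nw \<Longrightarrow>
          window_residual Ns f t dt s \<alpha> \<beta> Nt j (u j) (u0 j) = 0\<^sub>v (Ns * Nt j)"
    \<comment> \<open>WST-LSPG solution\<close>
    and V_carrier: "\<And>j. j < Nw \<Longrightarrow> V j \<in> carrier_mat (Ns * Nt j) (nb j)"
    and ut0_init: "ut0 0 = u_init"
    and ut0_Suc: "\<And>j. Suc j < Nw \<Longrightarrow> ut0 (Suc j) = block Ns (ut j) (Nt j)"
    and S_eq: "\<And>j. j < Nw \<Longrightarrow> S j = trial_space Ns (Nt j) (V j) (ut0 j)"
    and wst_lspg: "\<And>j. j < Nw \<Longrightarrow>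
          is_arg_min (\<lambda>w. (l2norm (window_residual Ns f t dt s \<alpha> \<beta> Nt j w (ut0 j)))\<^sup>2)
            (\<lambda>w. w \<in> S j) (ut j)"
    \<comment> \<open>the window considered and the assumptions (A1), (A2)\<close>
    and k: "k < Nw"
    and kappa_pos: "0 < \<kappa>"
    and A1: "\<And>w y \<tau>. w \<in> carrier_vec Ns \<Longrightarrow> y \<in> carrier_vec Ns \<Longrightarrow> \<tau> \<in> {0..T} \<Longrightarrow>
          l2norm (f w \<tau> - f y \<tau>) \<le> \<kappa> * l2norm (w - y)"
    and a_eq: "a = sigma_min (window_mat Ns s Nt \<alpha> k)
                   - sigma_max (window_mat Ns s Nt \<beta> k) * dt * \<kappa>"
    and b_eq: "b = sigma_max (window_mat0 Ns s Nt \<alpha> k)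
                   + dt * \<kappa> * sigma_max (window_mat0 Ns s Nt \<beta> k)"
    and A2: "0 < a"
    \<comment> \<open>projections of the full-order solution and of its starting state\<close>
    and Pu_eq: "Pu = l2_proj (S k) (u k)"
    and Pu0_eq: "Pu0 = (if k = 0 then u_init
          else l2_proj ((\<lambda>w. block Ns w (Nt (k - 1))) ` S (k - 1)) (u0 k))"
  shows "l2norm (ut k - u k)
           \<le> 1 / a * l2norm (window_residual Ns f t dt s \<alpha> \<beta> Nt k Pu Pu0)
             + 2 * b / a * l2norm (ut0 k - u0 k)"
proof -
  have theta_le: "theta Nt k + l - 1 \<le> N" if "l \<le> Nt k" for l
  proof -
    have "(\<Sum>j<Suc k. Nt j) \<le> (\<Sum>j<Nw. Nt j)"
      using k by (intro sum_mono2) auto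
    then show ?thesis
      using that Nt_sum by (simp add: theta_def)
  qed
  then have time: "t (theta Nt k + l - 1) \<in> {0..T}" if "l \<le> Nt k" for l
    using t_range that by blast
  \<comment> \<open>The starting state sits one step before the window, which is the case
    \<open>l = 0\<close>.\<close>
  then have time0: "t (theta Nt k - 1) \<in> {0..T}"
    using time[of 0] by simp
  have u0_carrier: "u0 j \<in> carrier_vec Ns" if "j < Nw" for j
    using that u0_init u_init_carrier u0_Suc by (cases j) auto
  have ut0_carrier: "ut0 j \<in> carrier_vec Ns" if "j < Nw" for j
    using that ut0_init u_init_carrier ut0_Suc by (cases j) auto
  have ut_S: "ut j \<in> S j" if "j < Nw" for j
    using wst_lspg[OF that] by (simp add: is_arg_min_def)
  have S_affine: "S j = {stack Ns (Nt j) (\<lambda>_. ut0 j) + V j *\<^sub>v z | z. z \<in> carrier_vec (nb j)}"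
    if "j < Nw" for j
    using S_eq[OF that] V_carrier[OF that] by (simp add: trial_space_def)
  have S_carrier: "w \<in> carrier_vec (Ns * Nt k)" if "w \<in> S k" for w
    using that V_carrier[OF k] by (auto simp: S_affine[OF k])
  have Pu_S: "Pu \<in> S k"
    unfolding Pu_eq by (rule l2_proj_affine_mem[OF V_carrier[OF k] _ u_carrier[OF k] S_affine[OF k]]) simp
  have Pu0: "Pu0 \<in> carrier_vec Ns \<and> l2norm (ut0 k - Pu0) \<le> l2norm (ut0 k - u0 k)"
  proof (cases k)
    case 0
    then show ?thesis
      using Pu0_eq ut0_init u0_init u_init_carrier by simp
  next
    case (Suc j)
    have j: "j < Nw" and L: "Nt j \<in> {1..Nt j}"
      using Suc k Nt_pos[of j] by auto
    define W where "W = (\<lambda>w. block Ns w (Nt j)) ` S j"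
    have "W = {ut0 j + mat Ns (nb j) (\<lambda>(i, q). V j $$ ((Nt j - 1) * Ns + i, q)) *\<^sub>v z | z. z \<in> carrier_vec (nb j)}"
      unfolding W_def S_eq[OF j] by (rule block_trial_space[OF V_carrier[OF j] ut0_carrier[OF j] L])
    note proj = l2_proj_affine[OF _ ut0_carrier[OF j] u0_carrier[OF k] this]
    have Pu0: "Pu0 = l2_proj W (u0 k)"
      using Pu0_eq Suc by (simp add: W_def)
    then have "Pu0 \<in> W"
      using proj(1) by simp
    \<comment> \<open>The computed starting state is the last block of an element of the previous
      trial space, hence a fixed point of the projection.\<close>
    moreover have "ut0 k \<in> W"
      using ut0_Suc[of j] Suc k ut_S[OF j] by (auto simp: W_def)
    ultimately show ?thesis
      using proj(2)[of "ut0 k"] by (auto simp: Pu0 W_def)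
  qed
  then have Pu0_carrier: "Pu0 \<in> carrier_vec Ns"
    by simp
  define r where "r = window_residual Ns f t dt s \<alpha> \<beta> Nt k"
  define M L where "M = window_mat Ns s Nt" and "L = window_mat0 Ns s Nt"
  have M: "M c k \<in> carrier_mat (Ns * Nt k) (Ns * Nt k)" and L: "L c k \<in> carrier_mat (Ns * Nt k) Ns" for c
    by (simp_all add: M_def L_def)
  define G where "G w = M \<alpha> k *\<^sub>v w - dt \<cdot>\<^sub>v (M \<beta> k *\<^sub>v window_rhs Ns f t Nt k w)" for w
  define H where "H w0 = L \<alpha> k *\<^sub>v w0 - dt \<cdot>\<^sub>v (L \<beta> k *\<^sub>v f w0 (t (theta Nt k - 1)))" for w0
  have r_eq: "r w w0 = G w + H w0" if "w \<in> carrier_vec (Ns * Nt k)" "w0 \<in> carrier_vec Ns" for w w0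
    unfolding r_def G_def H_def M_def L_def
    using window_residual_matrix_form[where Nt = Nt and k = k and f = f and t = t and s = s,
        OF that f_carrier[OF that(2) time0] stencil[OF k]] .
  have G_carrier: "G w \<in> carrier_vec (Ns * Nt k)" for w
    by (rule carrier_vecI) (simp add: G_def M_def)
  have H_carrier: "H w \<in> carrier_vec (Ns * Nt k)" for w
    by (rule carrier_vecI) (simp add: H_def L_def)
  have dims: "0 < Ns * Nt k" "Ns \<le> Ns * Nt k"
    using Ns_pos Nt_pos[OF k] by auto
  have b_nonneg: "0 \<le> b"
    unfolding b_eq L_def[symmetric] using dt_pos kappa_pos sigma_max_nonneg[OF L Ns_pos dims(2)] by simp
  have rhs: "window_rhs Ns f t Nt k w \<in> carrier_vec (Ns * Nt k)" for w
    by simp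
  have G_lower: "a * l2norm (w - y) \<le> l2norm (G w - G y)"
    if wy: "w \<in> carrier_vec (Ns * Nt k)" "y \<in> carrier_vec (Ns * Nt k)" for w y
  proof -
    have "l2norm (window_rhs Ns f t Nt k w - window_rhs Ns f t Nt k y) \<le> \<kappa> * l2norm (w - y)"
    proof (rule window_rhs_lipschitz)
      fix x z :: "real vec" and l
      assume x: "x \<in> carrier_vec Ns" and l: "l \<in> {1..Nt k}"
      show "f x (t (theta Nt k + l - 1)) \<in> carrier_vec Ns"
        using l by (intro f_carrier[OF x] time) simp
      assume z: "z \<in> carrier_vec Ns"
      show "l2norm (f x (t (theta Nt k + l - 1)) - f z (t (theta Nt k + l - 1))) \<le> \<kappa> * l2norm (x - z)"
        using l by (intro A1[OF x z] time) simp
    qed (use wy kappa_pos in auto)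
    then show ?thesis
      unfolding G_def a_eq M_def[symmetric] affine_diff[OF M M wy rhs rhs]
      using wy rhs dims dt_pos by (intro l2norm_affine_lower[OF M M]) auto
  qed
  have H_upper: "l2norm (H v - H w) \<le> b * l2norm (v - w)"
    if vw: "v \<in> carrier_vec Ns" "w \<in> carrier_vec Ns" for v w
  proof -
    note f = f_carrier[OF vw(1) time0] f_carrier[OF vw(2) time0]
    show ?thesis
      unfolding H_def b_eq L_def[symmetric] affine_diff[OF L L vw f]
      using vw f dims Ns_pos dt_pos A1[OF vw time0]
      by (intro l2norm_affine_upper[OF L L]) auto
  qed
  note ut_carrier = S_carrier[OF ut_S[OF k]] and Pu_carrier = S_carrier[OF Pu_S]
  have "G (ut k) - G (u k) = r (ut k) (ut0 k) - (H (ut0 k) - H (u0 k))"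
  proof -
    \<comment> \<open>The vanishing full-order residual allows \<open>G (u k)\<close> to be replaced
      by \<open>- H (u0 k)\<close>.\<close>
    have "G (u k) + H (u0 k) = 0\<^sub>v (Ns * Nt k)"
      using full_order[OF k] r_eq[OF u_carrier[OF k] u0_carrier[OF k]] by (simp add: r_def)
    then have "G (u k) $ i + H (u0 k) $ i = 0" if "i < Ns * Nt k" for i
      using that H_carrier[of "u0 k"] by (metis carrier_vecD index_add_vec(1) index_zero_vec(1))
    then show ?thesis
      unfolding r_eq[OF ut_carrier ut0_carrier[OF k]]
      using G_carrier[THEN carrier_vecD] H_carrier[THEN carrier_vecD]
      by (intro eq_vecI) (auto simp: algebra_simps)
  qed
  then have "a * l2norm (ut k - u k) \<le> l2norm (r (ut k) (ut0 k) - (H (ut0 k) - H (u0 k)))"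
    using G_lower[OF ut_carrier u_carrier[OF k]] by simp
  also have "\<dots> \<le> l2norm (r (ut k) (ut0 k)) + l2norm (H (ut0 k) - H (u0 k))"
    by (rule l2norm_minus_le[of _ "Ns * Nt k"]) (simp_all add: r_def H_carrier)
  also have "l2norm (H (ut0 k) - H (u0 k)) \<le> b * l2norm (ut0 k - u0 k)"
    by (rule H_upper[OF ut0_carrier[OF k] u0_carrier[OF k]])
  \<comment> \<open>Minimality compares residuals with the same starting state \<open>ut0 k\<close>,
    so \<open>Pu0\<close> can enter only afterwards.\<close>
  also have "l2norm (r (ut k) (ut0 k)) \<le> l2norm (r Pu (ut0 k))"
  proof -
    have "(l2norm (r (ut k) (ut0 k)))\<^sup>2 \<le> (l2norm (r Pu (ut0 k)))\<^sup>2"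
      using wst_lspg[OF k] Pu_S by (auto simp: is_arg_min_def r_def not_less)
    then show ?thesis
      by (rule power2_le_imp_le) simp
  qed
  also have "r Pu (ut0 k) = r Pu Pu0 + (H (ut0 k) - H Pu0)"
    unfolding r_eq[OF Pu_carrier ut0_carrier[OF k]] r_eq[OF Pu_carrier Pu0_carrier]
    using G_carrier[THEN carrier_vecD] H_carrier[THEN carrier_vecD]
    by (intro eq_vecI) auto
  also have "l2norm \<dots> \<le> l2norm (r Pu Pu0) + l2norm (H (ut0 k) - H Pu0)"
    by (rule l2norm_add_le[of _ "Ns * Nt k"]) (simp_all add: r_def H_carrier)
  \<comment> \<open>This exchange of starting states contributes the second \<open>b\<close>, hence
    the factor 2.\<close>
  also have "l2norm (H (ut0 k) - H Pu0) \<le> b * l2norm (ut0 k - u0 k)"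
    using H_upper[OF ut0_carrier[OF k] Pu0_carrier] Pu0 b_nonneg
    by (meson mult_left_mono order_trans)
  finally have "a * l2norm (ut k - u k) \<le> l2norm (r Pu Pu0) + 2 * b * l2norm (ut0 k - u0 k)"
    by simp
  then have "l2norm (ut k - u k) \<le> (l2norm (r Pu Pu0) + 2 * b * l2norm (ut0 k - u0 k)) / a"
    using A2 by (simp add: pos_le_divide_eq mult.commute)
  then show ?thesis
    by (simp add: r_def add_divide_distrib)
qed

end
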